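(* Let $r\ge 2$, let $w^{(1)},\dots,w^{(r)}$ be a perfect system of weights on $\mathbb R$, and let $\vec n=(n_1,\dots,n_r)\in\mathbb N^r$ be a multi-index with $n=|\vec n|=n_1+\dots+n_r\ge 1$. Then the type II multiple orthogonal polynomial $P_{\vec n}$ satisfies $$P_{\vec n}(x)=p_n(x)-\boldsymbol v_2^\top \boldsymbol M_{22}^{-1}\boldsymbol p_2(x)=\frac{1}{\det \boldsymbol M_{22}}\det\begin{pmatrix}\boldsymbol M_{22} & \boldsymbol p_2(x)\\ \boldsymbol v_2^\top & p_n(x)\end{pmatrix}.$$
   Context: Weights: $w^{(1)},\dots,w^{(r)}$ are densities (with respect to Lebesgue measure) of positive measures on $\mathbb R$ all of whose moments exist. $\mathbb N=\{0,1,2,\dots\}$; empty blocks contribute $0$ to sums and $1$ to determinants. Type II polynomial: $P_{\vec n}$ is a monic polynomial of degree $n=|\vec n|$ with $\int_{\mathbb R}P_{\vec n}(x)x^k w^{(j)}(x)\,dx=0$ for $k=0,\dots,n_j-1$, $j=1,\dots,r$. Type I: a nonzero vector of polynomials $(A_1,\dots,A_r)$ with $\deg A_j\le n_j-1$ such that $Q_{\vec n}(x)=\sum_{j=1}^r A_j(x)w^{(j)}(x)$ satisfies $\int_{\mathbb R}Q_{\vec n}(x)x^k\,dx=0$ for $k=0,\dots,n-2$ and $=1$ for $k=n-1$. The system is perfect if for every (nonzero) multi-index in $\mathbb N^r$ the type I and type II objects exist and are unique. Reference orthogonal polynomials: $p_k$ is the monic polynomial of degree $k$ with $\int_{\mathbb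 R}p_k(x)p_m(x)w^{(1)}(x)\,dx=h_k\delta_{km}$. Vectors and matrices: $\boldsymbol p(x)=(p_0(x),\dots,p_{n-1}(x))^\top$; $\boldsymbol q(x)$ is the $n$-column vector obtained by stacking, for $j=1,\dots,r$ in this order, the blocks $(p_0(x)w^{(j)}(x),\dots,p_{n_j-1}(x)w^{(j)}(x))^\top$; $\boldsymbol v=\int_{\mathbb R}p_n(x)\boldsymbol q(x)\,dx$; $\boldsymbol M=\int_{\mathbb R}\boldsymbol p(s)\boldsymbol q(s)^\top ds$ (an $n\times n$ matrix). Index sets are split into the first $n_1$ and the last $n-n_1$ positions; $\boldsymbol p_2(x)=(p_{n_1}(x),\dots,p_{n-1}(x))^\top$ and $\boldsymbol v_2$ are the last $n-n_1$ components of $\boldsymbol p(x)$ and $\boldsymbol v$, and $\boldsymbol M_{22}$ is the lower-right $(n-n_1)\times(n-n_1)$ block of $\boldsymbol M$. *)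

theory Defs
  imports
    "HOL-Analysis.Lebesgue_Measure"
    "HOL-Computational_Algebra.Polynomial"
    "Jordan_Normal_Form.Determinant"
    "Jordan_Normal_Form.Gauss_Jordan_Elimination"
begin

text \<open>Weights \<open>w j\<close> and multi-indices \<open>ns j\<close> are families on \<^typ>\<open>nat\<close> of which only the
  entries \<open>j \<in> {1..r}\<close> are relevant.\<close>

text \<open>A density is determined only up to null sets, hence the almost-everywhere sign condition.
  The case \<open>k = 0\<close> makes \<open>w\<close> Borel measurable.\<close>

definition is_weight :: "(real \<Rightarrow> real) \<Rightarrow> bool" where
  "is_weight w \<longleftrightarrow>
     (AE x in lborel. 0 \<le> w x) \<and> (\<forall>k::nat. integrable lborel (\<lambda>x. x ^ k * w x))"

definition mi_size :: "nat \<Rightarrow> (nat \<Rightarrow> nat) \<Rightarrow> nat" where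
  "mi_size r ns = (\<Sum>j=1..r. ns j)"

definition is_type_II ::
  "nat \<Rightarrow> (nat \<Rightarrow> real \<Rightarrow> real) \<Rightarrow> (nat \<Rightarrow> nat) \<Rightarrow> real poly \<Rightarrow> bool" where
  "is_type_II r w ns P \<longleftrightarrow>
     degree P = mi_size r ns \<and> lead_coeff P = 1 \<and>
     (\<forall>j\<in>{1..r}. \<forall>k<ns j. (\<integral>x. poly P x * x ^ k * w j x \<partial>lborel) = 0)"

text \<open>The bound \<open>deg A\<^sub>j \<le> n\<^sub>j - 1\<close> is read as \<open>A\<^sub>j = 0\<close> when \<open>n\<^sub>j = 0\<close>. The entries outside
  \<open>{1..r}\<close> are set to zero so that uniqueness of \<open>A\<close> means uniqueness of \<open>(A\<^sub>1, \<dots>, A\<^sub>r)\<close>.\<close>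

definition is_type_I ::
  "nat \<Rightarrow> (nat \<Rightarrow> real \<Rightarrow> real) \<Rightarrow> (nat \<Rightarrow> nat) \<Rightarrow> (nat \<Rightarrow> real poly) \<Rightarrow> bool" where
  "is_type_I r w ns A \<longleftrightarrow>
     (\<forall>j. j \<notin> {1..r} \<longrightarrow> A j = 0) \<and>
     (\<exists>j\<in>{1..r}. A j \<noteq> 0) \<and>
     (\<forall>j\<in>{1..r}. A j = 0 \<or> degree (A j) < ns j) \<and>
     (let n = mi_size r ns; Q = (\<lambda>x. \<Sum>j=1..r. poly (A j) x * w j x) in
        (\<forall>k. k + 1 < n \<longrightarrow> (\<integral>x. Q x * x ^ k \<partial>lborel) = 0) \<and>
        (\<integral>x. Q x * x ^ (n - 1) \<partial>lborel) = 1)"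

definition perfect_system :: "nat \<Rightarrow> (nat \<Rightarrow> real \<Rightarrow> real) \<Rightarrow> bool" where
  "perfect_system r w \<longleftrightarrow>
     (\<forall>ns. mi_size r ns \<ge> 1 \<longrightarrow> (\<exists>!A. is_type_I r w ns A) \<and> (\<exists>!P. is_type_II r w ns P))"

definition monic_orthogonal_polys :: "(real \<Rightarrow> real) \<Rightarrow> (nat \<Rightarrow> real poly) \<Rightarrow> bool" where
  "monic_orthogonal_polys w p \<longleftrightarrow>
     (\<forall>k. degree (p k) = k \<and> lead_coeff (p k) = 1) \<and>
     (\<exists>h. \<forall>k m. (\<integral>x. poly (p k) x * poly (p m) x * w x \<partial>lborel) = (if k = m then h k else 0))"

definition p_vec :: "(nat \<Rightarrow> real poly) \<Rightarrow> nat \<Rightarrow> real \<Rightarrow> real Matrix.vec" where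
  "p_vec p n x = Matrix.vec n (\<lambda>i. poly (p i) x)"

definition q_vec ::
  "nat \<Rightarrow> (nat \<Rightarrow> real \<Rightarrow> real) \<Rightarrow> (nat \<Rightarrow> nat) \<Rightarrow> (nat \<Rightarrow> real poly) \<Rightarrow> real \<Rightarrow> real Matrix.vec" where
  "q_vec r w ns p x =
     vec_of_list (concat (map (\<lambda>j. map (\<lambda>k. poly (p k) x * w j x) [0..<ns j]) [1..<Suc r]))"

definition v_vec ::
  "nat \<Rightarrow> (nat \<Rightarrow> real \<Rightarrow> real) \<Rightarrow> (nat \<Rightarrow> nat) \<Rightarrow> (nat \<Rightarrow> real poly) \<Rightarrow> real Matrix.vec" where
  "v_vec r w ns p = (let n = mi_size r ns in
     Matrix.vec n (\<lambda>i. \<integral>x. poly (p n) x * vec_index (q_vec r w ns p x) i \<partial>lborel))"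

definition M_mat ::
  "nat \<Rightarrow> (nat \<Rightarrow> real \<Rightarrow> real) \<Rightarrow> (nat \<Rightarrow> nat) \<Rightarrow> (nat \<Rightarrow> real poly) \<Rightarrow> real Matrix.mat" where
  "M_mat r w ns p = (let n = mi_size r ns in
     Matrix.mat n n (\<lambda>(i, j).
       \<integral>s. vec_index (p_vec p n s) i * vec_index (q_vec r w ns p s) j \<partial>lborel))"

definition p2_vec :: "nat \<Rightarrow> (nat \<Rightarrow> nat) \<Rightarrow> (nat \<Rightarrow> real poly) \<Rightarrow> real \<Rightarrow> real Matrix.vec" where
  "p2_vec r ns p x = (let n = mi_size r ns in vec_last (p_vec p n x) (n - ns 1))"

definition v2_vec ::
  "nat \<Rightarrow> (nat \<Rightarrow> real \<Rightarrow> real) \<Rightarrow> (nat \<Rightarrow> nat) \<Rightarrow> (nat \<Rightarrow> real poly) \<Rightarrow> real Matrix.vec" where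
  "v2_vec r w ns p = vec_last (v_vec r w ns p) (mi_size r ns - ns 1)"

definition M22_mat ::
  "nat \<Rightarrow> (nat \<Rightarrow> real \<Rightarrow> real) \<Rightarrow> (nat \<Rightarrow> nat) \<Rightarrow> (nat \<Rightarrow> real poly) \<Rightarrow> real Matrix.mat" where
  "M22_mat r w ns p =
     (case split_block (M_mat r w ns p) (ns 1) (ns 1) of (_, _, _, M22) \<Rightarrow> M22)"

text \<open>Unspecified for singular matrices.\<close>

definition mat_inv :: "real Matrix.mat \<Rightarrow> real Matrix.mat" where
  "mat_inv A = the (mat_inverse A)"

definition bordered_mat ::
  "real Matrix.mat \<Rightarrow> real Matrix.vec \<Rightarrow> real Matrix.vec \<Rightarrow> real \<Rightarrow> real Matrix.mat" where
  "bordered_mat A b c d =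
     four_block_mat A (mat_of_cols (dim_vec b) [b]) (mat_of_row c) (Matrix.mat 1 1 (\<lambda>_. d))"

end

theory Submission
  imports Defs
begin

text \<open>For a vector \<open>d\<close> of length \<open>n - n\<^sub>1\<close> let \<open>R\<^sub>d\<close> be the combination of
  \<open>p\<^bsub>n\<^sub>1\<^esub>, \<dots>, p\<^bsub>n-1\<^esub>\<close> with coefficients \<open>d\<close>. It is orthogonal to the lower \<open>p\<^sub>k\<close> with respect
  to the first weight, and the transpose of \<open>M\<^sub>2\<^sub>2\<close> applied to \<open>d\<close> lists its integrals against the
  remaining entries of \<open>q\<close>. If these all vanish, then \<open>P + R\<^sub>d\<close> is again a type II polynomial, so
  \<open>d = 0\<close> by uniqueness: \<open>M\<^sub>2\<^sub>2\<close> is invertible. If they are the entries of \<open>v\<^sub>2\<close>, then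
  \<open>p\<^sub>n - R\<^sub>d\<close> is of type II, hence equals \<open>P\<close>. The determinant formula is the Schur
  complement form of this.\<close>

section \<open>Integration of polynomials against a weight\<close>

text \<open>Taking a formal polynomial instead of a function lets linearity of the integral be used
  by calculating in \<open>real poly\<close>.\<close>

definition wint :: "(real \<Rightarrow> real) \<Rightarrow> real poly \<Rightarrow> real" where
  "wint w f = (\<integral>x. poly f x * w x \<partial>lborel)"

lemma integrable_poly_weight:
  assumes "is_weight w"
  shows "integrable lborel (\<lambda>x. poly f x * w x)"
proof -
  have "integrable lborel (\<lambda>x. \<Sum>i\<le>degree f. coeff f i * (x ^ i * w x))"
    using assms unfolding is_weight_def
    by (intro Bochner_Integration.integrable_sum integrable_mult_right) auto
  moreover have "(\<lambda>x. \<Sum>i\<le>degree f. coeff f i * (x ^ i * w x)) = (\<lambda>x. poly f x * w x)"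
    by (simp add: poly_altdef sum_distrib_right mult.assoc)
  ultimately show ?thesis by simp
qed

lemma wint_add: "is_weight w \<Longrightarrow> wint w (f + g) = wint w f + wint w g"
  unfolding wint_def by (simp add: distrib_right integrable_poly_weight)

lemma wint_smult: "wint w (Polynomial.smult c f) = c * wint w f"
  unfolding wint_def by (simp add: mult.assoc)

lemma wint_diff: "is_weight w \<Longrightarrow> wint w (f - g) = wint w f - wint w g"
  unfolding wint_def by (simp add: left_diff_distrib integrable_poly_weight)

lemma wint_0 [simp]: "wint w 0 = 0"
  unfolding wint_def by simp

lemma wint_sum: "is_weight w \<Longrightarrow> wint w (\<Sum>i\<in>A. f i) = (\<Sum>i\<in>A. wint w (f i))"
  by (induction A rule: infinite_finite_induct) (simp_all add: wint_add)

section \<open>Expansions in a sequence of monic polynomials\<close>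

text \<open>Subtracting the right multiple of \<open>p m\<close> removes the top coefficient.
  Bounding coefficients instead of the degree makes \<open>m = 0\<close> mean \<open>f = 0\<close>,
  the base of the induction.\<close>

lemma poly_eq_sum_monic_basis:
  fixes p :: "nat \<Rightarrow> 'a :: comm_ring_1 poly"
  assumes p: "\<And>k. degree (p k) = k" "\<And>k. lead_coeff (p k) = 1"
    and "\<And>i. i \<ge> m \<Longrightarrow> coeff f i = 0"
  obtains c where "f = (\<Sum>i<m. Polynomial.smult (c i) (p i))"
  using assms(3)
proof (induction m arbitrary: f thesis)
  case 0
  then show ?case by (simp add: poly_eq_iff)
next
  case (Suc m)
  let ?g = "f - Polynomial.smult (coeff f m) (p m)"
  have "coeff ?g i = 0" if "i \<ge> m" for i
    using that p[of m] Suc.prems(2)[of i] by (cases "i = m") (auto simp: coeff_eq_0)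
  then obtain c where c: "?g = (\<Sum>i<m. Polynomial.smult (c i) (p i))"
    using Suc.IH[of ?g] by blast
  have "(\<Sum>i<m. Polynomial.smult ((c(m := coeff f m)) i) (p i)) =
      (\<Sum>i<m. Polynomial.smult (c i) (p i))"
    by (intro sum.cong) auto
  with c show ?case
    by (intro Suc.prems(1)[of "c(m := coeff f m)"]) (simp add: algebra_simps)
qed

lemma sum_monic_basis_eq_0:
  fixes p :: "nat \<Rightarrow> 'a :: idom poly"
  assumes p: "\<And>k. degree (p k) = k" "\<And>k. lead_coeff (p k) = 1"
    and "(\<Sum>i<m. Polynomial.smult (c i) (p (a + i))) = 0" "i < m"
  shows "c i = 0"
  using assms(3,4)
proof (induction m)
  case (Suc m)
  \<comment> \<open>Only \<open>p (a + m)\<close> reaches degree \<open>a + m\<close>, so that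
    coefficient isolates \<open>c m\<close>.\<close>
  have "coeff (\<Sum>i<m. Polynomial.smult (c i) (p (a + i))) (a + m) = 0"
    by (auto simp: coeff_sum p(1) intro!: sum.neutral coeff_eq_0)
  then have "coeff (\<Sum>i<Suc m. Polynomial.smult (c i) (p (a + i))) (a + m) = c m"
    using p[of "a + m"] by simp
  then have "c m = 0"
    using Suc.prems(1) by (metis coeff_0)
  with Suc show ?case by (cases "i = m") auto
qed simp

text \<open>Bridge between the matrix entries, which test against \<open>p k\<close>, and
  \<open>is_type_II\<close>, which tests against powers of \<open>x\<close>.\<close>

lemma wint_monomials_eq_0:
  assumes w: "is_weight w" and p: "\<And>k. degree (p k) = k" "\<And>k. lead_coeff (p k) = 1"
    and orth: "\<And>i. i < m \<Longrightarrow> wint w (f * p i) = 0" and "k < m"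
  shows "(\<integral>x. poly f x * x ^ k * w x \<partial>lborel) = 0"
proof -
  obtain c where c: "Polynomial.monom 1 k = (\<Sum>i<m. Polynomial.smult (c i) (p i))"
    using poly_eq_sum_monic_basis[of p m "Polynomial.monom 1 k"] p \<open>k < m\<close> by force
  have "wint w (f * Polynomial.monom 1 k) = 0"
    unfolding c using orth by (simp add: sum_distrib_left wint_sum[OF w] wint_smult)
  then show ?thesis
    by (simp add: wint_def poly_monom)
qed

lemma type_II_unique:
  assumes "perfect_system r w" "mi_size r ns \<ge> 1" "is_type_II r w ns P" "is_type_II r w ns P'"
  shows "P = P'"
  using assms unfolding perfect_system_def by blast

section \<open>Entries of the vectors and blocks in the last positions\<close>

text \<open>Labels the positions of \<open>q_vec\<close> after its first block by weight and
  polynomial index, which avoids arithmetic with partial sums of \<open>ns\<close>.\<close>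

definition tail_idx :: "nat \<Rightarrow> (nat \<Rightarrow> nat) \<Rightarrow> (nat \<times> nat) list" where
  "tail_idx r ns = concat (map (\<lambda>j. map (Pair j) [0..<ns j]) [2..<Suc r])"

lemma set_tail_idx: "set (tail_idx r ns) = {(j, k). j \<in> {2..r} \<and> k < ns j}"
  unfolding tail_idx_def by auto

lemma length_tail_idx:
  assumes "r \<ge> 1"
  shows "length (tail_idx r ns) = mi_size r ns - ns 1" "ns 1 \<le> mi_size r ns"
proof -
  have "length (tail_idx r ns) = (\<Sum>j\<in>{2..<Suc r}. ns j)"
    unfolding tail_idx_def by (simp add: length_concat comp_def interv_sum_list_conv_sum_set_nat)
  moreover have "mi_size r ns = ns 1 + (\<Sum>j\<in>{2..<Suc r}. ns j)"
    unfolding mi_size_def using assms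
    by (simp add: sum.atLeast_Suc_atMost atLeastLessThanSuc_atLeastAtMost numeral_2_eq_2)
  ultimately show "length (tail_idx r ns) = mi_size r ns - ns 1" "ns 1 \<le> mi_size r ns"
    by auto
qed

lemma q_vec_tail:
  assumes "r \<ge> 1" "t < length (tail_idx r ns)" "tail_idx r ns ! t = (j, k)"
  shows "vec_index (q_vec r w ns p x) (t + ns 1) = poly (p k) x * w j x"
proof -
  have "[1..<Suc r] = 1 # [2..<Suc r]"
    using assms(1) by (simp add: upt_conv_Cons numeral_2_eq_2)
  then have "concat (map (\<lambda>j. map (\<lambda>k. poly (p k) x * w j x) [0..<ns j]) [1..<Suc r]) =
      map (\<lambda>k. poly (p k) x * w 1 x) [0..<ns 1] @
      map (\<lambda>(j, k). poly (p k) x * w j x) (tail_idx r ns)"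
    by (simp add: tail_idx_def map_concat comp_def)
  then show ?thesis
    unfolding q_vec_def using assms(2,3) by (simp add: vec_of_list_index nth_append)
qed

lemma M22_index:
  assumes "r \<ge> 1" "i < mi_size r ns - ns 1" "t < mi_size r ns - ns 1"
    "tail_idx r ns ! t = (j, k)"
  shows "M22_mat r w ns p $$ (i, t) = wint (w j) (p (ns 1 + i) * p k)"
proof -
  have "t < length (tail_idx r ns)"
    using assms by (simp add: length_tail_idx)
  note q = q_vec_tail[OF assms(1) this assms(4)]
  have "M22_mat r w ns p $$ (i, t) =
      (\<integral>x. poly (p (ns 1 + i)) x * vec_index (q_vec r w ns p x) (t + ns 1) \<partial>lborel)"
    using assms(2,3) length_tail_idx(2)[OF assms(1), of ns]
    by (simp add: M22_mat_def split_block_def M_mat_def Let_def p_vec_def add.commute)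
  then show ?thesis
    by (simp add: q wint_def mult.assoc del: One_nat_def)
qed

lemma M22_carrier:
  "M22_mat r w ns p \<in> carrier_mat (mi_size r ns - ns 1) (mi_size r ns - ns 1)"
  by (auto simp: M22_mat_def split_block_def M_mat_def Let_def)

lemma v2_index:
  assumes "r \<ge> 1" "t < mi_size r ns - ns 1" "tail_idx r ns ! t = (j, k)"
  shows "vec_index (v2_vec r w ns p) t = wint (w j) (p (mi_size r ns) * p k)"
proof -
  have "t < length (tail_idx r ns)"
    using assms by (simp add: length_tail_idx)
  note q = q_vec_tail[OF assms(1) this assms(3)]
  have "vec_index (v2_vec r w ns p) t =
      (\<integral>x. poly (p (mi_size r ns)) x * vec_index (q_vec r w ns p x) (t + ns 1) \<partial>lborel)"
    using assms(2) length_tail_idx(2)[OF assms(1), of ns]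
    by (simp add: v2_vec_def vec_last_def v_vec_def Let_def add.commute)
  then show ?thesis
    by (simp add: q wint_def mult.assoc del: One_nat_def)
qed

lemma p2_index:
  assumes "r \<ge> 1" "t < mi_size r ns - ns 1"
  shows "vec_index (p2_vec r ns p x) t = poly (p (ns 1 + t)) x"
  using assms length_tail_idx(2)[OF assms(1), of ns]
  by (simp add: p2_vec_def vec_last_def p_vec_def Let_def add.commute)

section \<open>Inverse matrix and bordered determinant\<close>

lemma mat_inv_correct:
  assumes A: "A \<in> carrier_mat n n" and "Determinant.det A \<noteq> 0"
  shows "mat_inv A \<in> carrier_mat n n" "A * mat_inv A = 1\<^sub>m n" "mat_inv A * A = 1\<^sub>m n"
proof -
  \<comment> \<open>The instances \<open>undefined\<close> fill a dummy parameter of the matrix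
    ring, so that both facts concern the same ring.\<close>
  obtain B where "mat_inverse A = Some B"
    using mat_inverse(1)[OF A, of undefined] det_non_zero_imp_unit[OF assms, of undefined]
    by (cases "mat_inverse A") blast+
  with mat_inverse(2)[OF A, of B]
  show "mat_inv A \<in> carrier_mat n n" "A * mat_inv A = 1\<^sub>m n" "mat_inv A * A = 1\<^sub>m n"
    by (auto simp: mat_inv_def)
qed

text \<open>With \<open>u\<close> the solution of \<open>A u = b\<close>, the bordered matrix
  factors into a block lower triangular matrix with diagonal \<open>A\<close>, \<open>1\<close> and
  a block upper triangular one with diagonal \<open>1\<close>, \<open>s\<close>, where
  \<open>s\<close> is the Schur complement.\<close>

lemma det_bordered_mat:
  assumes A: "A \<in> carrier_mat n n" and "Determinant.det A \<noteq> 0"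
    and b: "b \<in> carrier_vec n" and c: "c \<in> carrier_vec n"
  shows "Determinant.det (bordered_mat A b c d) =
    Determinant.det A * (d - scalar_prod c (mat_inv A *\<^sub>v b))"
proof -
  note inv = mat_inv_correct[OF A assms(2)]
  define u where "u = mat_inv A *\<^sub>v b"
  define s where "s = d - scalar_prod c u"
  have u: "u \<in> carrier_vec n"
    unfolding u_def using inv(1) b by simp
  have Au: "A *\<^sub>v u = b"
    unfolding u_def using A b inv by (simp flip: assoc_mult_mat_vec)
  let ?U = "mat_of_cols n [u]" and ?C = "mat_of_row c" and ?D = "Matrix.mat 1 1 (\<lambda>_. s)"
  have 1: "A * ?U = mat_of_cols n [b]"
    using A u b by (intro eq_matI) (auto simp: mat_of_cols_index simp flip: Au)
  have 2: "?C * ?U = Matrix.mat 1 1 (\<lambda>_. scalar_prod c u)"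
    using c u by (intro eq_matI) auto
  have 3: "?C * ?U + ?D = Matrix.mat 1 1 (\<lambda>_. d)"
    unfolding 2 s_def by (intro eq_matI) auto
  have "bordered_mat A b c d =
      four_block_mat A (0\<^sub>m n 1) ?C (1\<^sub>m 1) * four_block_mat (1\<^sub>m n) ?U (0\<^sub>m 1 n) ?D"
    unfolding bordered_mat_def
    by (subst mult_four_block_mat[of _ n n _ 1 _ 1 _ _ n _ 1]) (use A b c 1 3 in auto)
  also have "Determinant.det \<dots> =
      Determinant.det (four_block_mat A (0\<^sub>m n 1) ?C (1\<^sub>m 1)) *
      Determinant.det (four_block_mat (1\<^sub>m n) ?U (0\<^sub>m 1 n) ?D)"
    using A c by (intro det_mult[of _ "n + 1"]) auto
  also have "Determinant.det (four_block_mat A (0\<^sub>m n 1) ?C (1\<^sub>m 1)) = Determinant.det A"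
    using A c by (subst det_four_block_mat_upper_right_zero_col[of _ n]) auto
  also have "Determinant.det (four_block_mat (1\<^sub>m n) ?U (0\<^sub>m 1 n) ?D) = s"
    by (subst det_four_block_mat_lower_left_zero[of _ n _ 1]) (auto simp: det_single)
  finally show ?thesis
    unfolding s_def u_def .
qed

section \<open>Invertibility of the block and the two formulas\<close>

theorem theorem3p1:
  fixes r :: nat and w :: "nat \<Rightarrow> real \<Rightarrow> real" and ns :: "nat \<Rightarrow> nat"
    and p :: "nat \<Rightarrow> real poly" and P :: "real poly"
  assumes "r \<ge> 2"
    and "\<forall>j\<in>{1..r}. is_weight (w j)"
    and "perfect_system r w"
    and "mi_size r ns \<ge> 1"
    and "monic_orthogonal_polys (w 1) p"
    and "is_type_II r w ns P"
  shows "invertible_mat (M22_mat r w ns p) \<and> Determinant.det (M22_mat r w ns p) \<noteq> 0 \<and>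
    (\<forall>x. poly P x = poly (p (mi_size r ns)) x -
           scalar_prod (v2_vec r w ns p) (mat_inv (M22_mat r w ns p) *\<^sub>v p2_vec r ns p x) \<and>
         poly P x = 1 / Determinant.det (M22_mat r w ns p) *
           Determinant.det (bordered_mat (M22_mat r w ns p) (p2_vec r ns p x) (v2_vec r w ns p)
             (poly (p (mi_size r ns)) x)))"
proof -
  define n where "n = mi_size r ns"
  define m where "m = n - ns 1"
  define A where "A = M22_mat r w ns p"
  define v where "v = v2_vec r w ns p"
  define R where "R d = (\<Sum>i<m. Polynomial.smult (vec_index d i) (p (ns 1 + i)))" for d
  have r1: "r \<ge> 1" using assms(1) by simp
  have n: "n = ns 1 + m" and len: "length (tail_idx r ns) = m"
    using length_tail_idx[OF r1, of ns] by (auto simp: m_def n_def)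
  have A: "A \<in> carrier_mat m m"
    unfolding A_def m_def n_def by (rule M22_carrier)
  have v: "v \<in> carrier_vec m"
    unfolding v_def v2_vec_def m_def n_def by simp
  have p2: "p2_vec r ns p x \<in> carrier_vec m" for x
    unfolding p2_vec_def m_def n_def by (simp add: Let_def)
  have wt: "is_weight (w j)" if "j \<in> {1..r}" for j
    using assms(2) that by blast
  have p: "\<And>k. degree (p k) = k" "\<And>k. lead_coeff (p k) = 1"
    using assms(5) unfolding monic_orthogonal_polys_def by blast+
  have orth: "wint (w 1) (p i * p k) = 0" if "i \<noteq> k" for i k
    using assms(5) that unfolding monic_orthogonal_polys_def wint_def by auto
  have wint_R: "wint (w j) (R d * p k) = (\<Sum>i<m. vec_index d i * wint (w j) (p (ns 1 + i) * p k))"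
    if "j \<in> {1..r}" for j k d
    by (simp add: R_def sum_distrib_right wint_sum[OF wt[OF that]] wint_smult)
  \<comment> \<open>Every index occurring in \<open>R d\<close> is at least \<open>ns 1\<close>,
    hence differs from \<open>k\<close>.\<close>
  have R_first: "wint (w 1) (R d * p k) = 0" if "k < ns 1" for d k
    using that r1 by (auto simp: wint_R orth intro!: sum.neutral simp del: One_nat_def)
  \<comment> \<open>The transpose enters because the polynomials combined by \<open>d\<close> label
    the rows of \<open>A\<close>.\<close>
  have R_tail: "vec_index (A\<^sup>T *\<^sub>v d) t = wint (w j) (R d * p k)"
    if d: "d \<in> carrier_vec m" and t: "t < m" "tail_idx r ns ! t = (j, k)" for d t j k
  proof -
    have "(j, k) \<in> set (tail_idx r ns)" using t len by (metis nth_mem)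
    then have "j \<in> {1..r}" by (auto simp: set_tail_idx)
    moreover have "A $$ (i, t) = wint (w j) (p (ns 1 + i) * p k)" if "i < m" for i
      using that t M22_index[OF r1] by (simp add: A_def m_def n_def)
    ultimately show ?thesis
      using A d t(1) by (simp add: wint_R scalar_prod_def mult.commute atLeast0LessThan)
  qed
  \<comment> \<open>Hence adding or subtracting \<open>R d\<close> keeps a polynomial of degree
    \<open>n\<close> monic, by \<open>monic\<close> below.\<close>
  have R_low: "coeff (R d) i = 0" if "i \<ge> n" for d i
    using that by (auto simp: R_def coeff_sum p(1) n intro!: sum.neutral coeff_eq_0)
  have R_poly: "poly (R d) x = scalar_prod d (p2_vec r ns p x)" for d x
    using p2[of x] p2_index[OF r1]
    by (simp add: R_def poly_sum scalar_prod_def m_def n_def atLeast0LessThan)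
  have monic: "degree (f + g) = n \<and> lead_coeff (f + g) = 1"
    if "degree f = n" "lead_coeff f = 1" "\<And>i. i \<ge> n \<Longrightarrow> coeff g i = 0" for f g :: "real poly"
  proof -
    have "coeff (f + g) n = 1" using that by auto
    moreover have "degree (f + g) \<le> n"
      using that by (intro degree_le) (auto simp: coeff_eq_0)
    ultimately show ?thesis
      using le_degree[of "f + g" n] by (metis le_antisym zero_neq_one)
  qed
  \<comment> \<open>Splits the orthogonality conditions into those of the first weight and those
    listed by \<open>tail_idx\<close>.\<close>
  have tail_orth: "wint (w j) (f * p k) = 0"
    if "\<And>t j k. t < m \<Longrightarrow> tail_idx r ns ! t = (j, k) \<Longrightarrow> wint (w j) (f * p k) = 0"
      and "\<And>k. k < ns 1 \<Longrightarrow> wint (w 1) (f * p k) = 0" and "j \<in> {1..r}" "k < ns j" for f j k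
  proof (cases "j = 1")
    case False
    then have "(j, k) \<in> set (tail_idx r ns)" using that by (auto simp: set_tail_idx)
    then show ?thesis using that(1) len by (metis in_set_conv_nth)
  qed (use that in auto)

  have kernel: "d = 0\<^sub>v m" if d: "d \<in> carrier_vec m" "A\<^sup>T *\<^sub>v d = 0\<^sub>v m" for d
  proof -
    have zero: "wint (w j) (R d * p k) = 0" if "j \<in> {1..r}" "k < ns j" for j k
      by (rule tail_orth[OF _ _ that]) (use R_tail[OF d(1)] d(2) R_first in auto)
    have "is_type_II r w ns (P + R d)"
      unfolding is_type_II_def
    proof (intro conjI ballI allI impI)
      fix j k assume jk: "j \<in> {1..r}" "k < ns j"
      have R0: "(\<integral>x. poly (R d) x * x ^ k * w j x \<partial>lborel) = 0"
        using wint_monomials_eq_0[OF wt[OF jk(1)] p zero[OF jk(1)] jk(2)] .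
      have P0: "(\<integral>x. poly P x * x ^ k * w j x \<partial>lborel) = 0"
        using assms(6) jk unfolding is_type_II_def by blast
      \<comment> \<open>Writing the power as a polynomial makes \<open>wint_add\<close> applicable,
        which takes care of integrability.\<close>
      have "wint (w j) ((P + R d) * Polynomial.monom 1 k) = 0"
        using P0 R0 by (simp add: distrib_right wint_add[OF wt[OF jk(1)]])
          (simp add: wint_def poly_monom)
      then show "(\<integral>x. poly (P + R d) x * x ^ k * w j x \<partial>lborel) = 0"
        by (simp add: wint_def poly_monom)
    qed (use monic[of P "R d"] R_low assms(6) in \<open>auto simp: is_type_II_def n_def\<close>)
    then have "R d = 0"
      using type_II_unique[OF assms(3,4,6)] by (metis add_cancel_right_right)
    \<comment> \<open>Linear independence of the \<open>p k\<close>, whose degrees are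
      distinct.\<close>
    then have "vec_index d i = 0" if "i < m" for i
      using sum_monic_basis_eq_0[OF p, of "vec_index d" "ns 1" m] that unfolding R_def by blast
    then show ?thesis using d(1) by auto
  qed
  then have "Determinant.det A\<^sup>T \<noteq> 0"
    using A det_0_iff_vec_prod_zero[of "A\<^sup>T" m] by auto
  then have det: "Determinant.det A \<noteq> 0"
    using det_transpose[OF A] by simp
  note inv = mat_inv_correct[OF A det]
  have invertible: "invertible_mat A"
    unfolding invertible_mat_def inverts_mat_def using A inv by auto

  \<comment> \<open>The solution of \<open>A\<^sup>T d = v\<close>, so that \<open>R d\<close> has
    the same integrals as \<open>p n\<close> against the tail of \<open>q\<close>.\<close>
  define d where "d = (mat_inv A)\<^sup>T *\<^sub>v v"
  have d: "d \<in> carrier_vec m"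
    unfolding d_def using inv(1) v by simp
  have "A\<^sup>T * (mat_inv A)\<^sup>T = 1\<^sub>m m"
    using transpose_mult[OF inv(1) A] inv(3) by simp
  then have Ad: "A\<^sup>T *\<^sub>v d = v"
    unfolding d_def using A inv(1) v by (simp flip: assoc_mult_mat_vec)
  have zero: "wint (w j) ((p n - R d) * p k) = 0" if jk: "j \<in> {1..r}" "k < ns j" for j k
  proof (rule tail_orth[OF _ _ jk])
    fix t j k assume t: "t < m" "tail_idx r ns ! t = (j, k)"
    have "(j, k) \<in> set (tail_idx r ns)" using t len by (metis nth_mem)
    then have "j \<in> {1..r}" by (auto simp: set_tail_idx)
    moreover have "vec_index v t = wint (w j) (p n * p k)"
      using t v2_index[OF r1] by (simp add: v_def m_def n_def)
    ultimately show "wint (w j) ((p n - R d) * p k) = 0"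
      using R_tail[OF d t] by (simp add: Ad left_diff_distrib wint_diff wt)
  next
    fix k assume "k < ns 1"
    \<comment> \<open>Since \<open>k < ns 1 \<le> n\<close>, both \<open>p n\<close> and
      \<open>R d\<close> are orthogonal to \<open>p k\<close>.\<close>
    then show "wint (w 1) ((p n - R d) * p k) = 0"
      using r1 by (simp add: left_diff_distrib wint_diff wt R_first orth n del: One_nat_def)
  qed
  have "is_type_II r w ns (p n - R d)"
    unfolding is_type_II_def
  proof (intro conjI ballI allI impI)
    fix j k assume jk: "j \<in> {1..r}" "k < ns j"
    show "(\<integral>x. poly (p n - R d) x * x ^ k * w j x \<partial>lborel) = 0"
      using wint_monomials_eq_0[OF wt[OF jk(1)] p zero[OF jk(1)] jk(2)] .
  qed (use monic[of "p n" "- R d"] R_low p in \<open>auto simp: n_def\<close>)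
  then have "P = p n - R d"
    using type_II_unique[OF assms(3,4,6)] by blast
  \<comment> \<open>Moving the transposed inverse across the scalar product turns the coefficients
    \<open>d\<close> into the stated form.\<close>
  moreover have "poly (R d) x = scalar_prod v (mat_inv A *\<^sub>v p2_vec r ns p x)" for x
    unfolding R_poly d_def by (rule transpose_vec_mult_scalar[OF inv(1) p2 v])
  ultimately have "poly P x = poly (p n) x - scalar_prod v (mat_inv A *\<^sub>v p2_vec r ns p x)" for x
    by simp
  then show ?thesis
    using invertible det det_bordered_mat[OF A det p2 v]
    unfolding A_def v_def n_def by simp
qed

end
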